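(* There is an absolute constant $C>0$ such that the following holds. Let $m\ge n$ and let $A\in\mathbb{R}^{m\times n}$ be a random matrix whose columns are drawn independently from the uniform distribution on the unit ball $\{x\in\mathbb{R}^m:\|x\|_2\le 1\}$. Then with probability at least $1-1/m^2$, $\mathrm{disc}(A)\le C$.
   Context: For $A\in\mathbb{R}^{m\times n}$, $\mathrm{disc}(A)=\min_{x\in\{-1,1\}^n}\|Ax\|_\infty$. *)

theory Defs
  imports "HOL-Probability.Probability"
begin

text \<open>
  The dimensions m and n range over the natural numbers inside the statement (the constant must not
  depend on them), so they cannot be types. Vectors in \<open>\<real>\<^sup>m\<close> are functions on \<open>{..<m}\<close>, and a matrix
  is a function \<open>A i j\<close> of which only the entries with \<open>i < m\<close> and \<open>j < n\<close> matter.
\<close>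

definition sup_norm :: "nat \<Rightarrow> (nat \<Rightarrow> real) \<Rightarrow> real" where
  "sup_norm m v = (MAX i\<in>{..<m}. \<bar>v i\<bar>)"

definition mat_vec :: "nat \<Rightarrow> (nat \<Rightarrow> nat \<Rightarrow> real) \<Rightarrow> (nat \<Rightarrow> real) \<Rightarrow> nat \<Rightarrow> real" where
  "mat_vec n A x i = (\<Sum>j<n. A i j * x j)"

definition disc :: "nat \<Rightarrow> nat \<Rightarrow> (nat \<Rightarrow> nat \<Rightarrow> real) \<Rightarrow> real" where
  "disc m n A = (MIN x \<in> {..<n} \<rightarrow>\<^sub>E {-1, 1}. sup_norm m (mat_vec n A x))"

abbreviation lborel_vec :: "nat \<Rightarrow> (nat \<Rightarrow> real) measure" where
  "lborel_vec m \<equiv> Pi\<^sub>M {..<m} (\<lambda>_. lborel)"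

definition unit_ball :: "nat \<Rightarrow> (nat \<Rightarrow> real) set" where
  "unit_ball m = {x \<in> space (lborel_vec m). L2_set x {..<m} \<le> 1}"

definition uniform_ball :: "nat \<Rightarrow> (nat \<Rightarrow> real) measure" where
  "uniform_ball m = uniform_measure (lborel_vec m) (unit_ball m)"

text \<open>
  The law of n independent columns: a sample \<open>a\<close> is a family of columns, \<open>a j\<close> being column j,
  so that the corresponding matrix has entries \<open>A i j = a j i\<close>.
\<close>

definition random_columns :: "nat \<Rightarrow> nat \<Rightarrow> (nat \<Rightarrow> nat \<Rightarrow> real) measure" where
  "random_columns m n = Pi\<^sub>M {..<n} (\<lambda>_. uniform_ball m)"

lemma emeasure_unit_ball:
  "emeasure (lborel_vec m) (unit_ball m) = ennreal (unit_ball_vol (real m))"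
proof -
  have "unit_ball m = {x. sqrt (\<Sum>i<m. (x i)\<^sup>2) \<le> 1} \<inter> space (lborel_vec m)"
    by (auto simp: unit_ball_def L2_set_def)
  then show ?thesis
    using emeasure_cball_aux[of "{..<m}" 1] by simp
qed

text \<open>The conditioning on the ball is not degenerate.\<close>

lemma prob_space_uniform_ball:
  "prob_space (uniform_ball m)"
  unfolding uniform_ball_def
proof (rule prob_space_uniform_measure)
  have "unit_ball_vol (real m) > 0"
    by simp
  then show "emeasure (lborel_vec m) (unit_ball m) \<noteq> 0"
    unfolding emeasure_unit_ball by (simp add: ennreal_eq_0_iff not_le)
  show "emeasure (lborel_vec m) (unit_ball m) \<noteq> \<infinity>"
    unfolding emeasure_unit_ball by simp
qed

lemma prob_space_random_columns:
  "prob_space (random_columns m n)"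
  unfolding random_columns_def by (intro prob_space_PiM prob_space_uniform_ball)

lemma unit_ball_sets [measurable]: "unit_ball m \<in> sets (lborel_vec m)"
  unfolding unit_ball_def L2_set_def by measurable

lemma disc_measurable [measurable]:
  "(\<lambda>a. disc m n (\<lambda>i j. a j i)) \<in> borel_measurable (random_columns m n)"
proof -
  have sets: "sets (random_columns m n) = sets (Pi\<^sub>M {..<n} (\<lambda>_. lborel_vec m))"
    unfolding random_columns_def uniform_ball_def by (intro sets_PiM_cong) simp_all
  have entry: "(\<lambda>a. a j i) \<in> borel_measurable (random_columns m n)" if "i < m" "j < n" for i j
  proof -
    have "(\<lambda>a. a j) \<in> random_columns m n \<rightarrow>\<^sub>M lborel_vec m"
      unfolding measurable_cong_sets[OF sets refl]
      using that by (intro measurable_component_singleton) simp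
    moreover have "(\<lambda>v. v i) \<in> borel_measurable (lborel_vec m)"
      using measurable_component_singleton[of i "{..<m}" "\<lambda>_. lborel :: real measure"] that by simp
    ultimately show ?thesis
      by (rule measurable_compose)
  qed
  show ?thesis
    unfolding disc_def sup_norm_def mat_vec_def using entry
    by (intro borel_measurable_Min borel_measurable_Max borel_measurable_abs borel_measurable_sum
        borel_measurable_times borel_measurable_const finite_PiE) auto
qed

end

theory Submission
  imports Defs
begin

text \<open>
  Write p = k/m. With high probability every set of k columns has, in every row, square norm
  O(p log(100/p)). Beck's partial colouring method then signs more than a quarter of
  any k columns at cost O(sqrt p log(100/p)) = O(p^(1/4)) in every row, and iterating on the
  columns left unsigned gives a geometric series with sum O((n/m)^(1/4)).

  Partial colouring is a pigeonhole argument: round the row sums of a random signing on the scale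
  of the permitted error. Weighting a rounded vector b by (p/100)^(|b_1| + ... + |b_m|) shows that
  some b is hit by at least (19/10)^k signings, too many to lie in a Hamming ball of radius k/4; half
  the difference of two distant ones is the partial colouring.

  The row bound comes from the exponential moment of a squared coordinate. To avoid a union
  bound over sets of columns, apply Markov's inequality to the product of
  1 + p exp(m a^2 / 8) over all entries a of a row, whose expansion dominates every set of k columns.
\<close>

section \<open>Exponential moments of random signs, rounding, and Hamming distance\<close>

text \<open>This is the analytic inequality behind Hoeffding's lemma for a fair sign, taken at p =
  1/2 and h = 2y; evenness of both sides reduces to y \<ge> 0.\<close>

lemma cosh_le_exp_half_square: "cosh (x::real) \<le> exp (x\<^sup>2 / 2)"
proof -
  have *: "cosh y \<le> exp (y\<^sup>2 / 2)" if "y \<ge> 0" for y :: real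
  proof -
    have pos: "1 + 1/2 * (exp (2*y) - 1) > 0"
      by (simp add: algebra_simps add_pos_pos)
    have eq: "1 + 1/2 * (exp (2*y) - 1) = exp y * cosh y"
      by (simp add: cosh_field_def algebra_simps flip: exp_add)
    have "- (2*y) * (1/2) + ln (1 + 1/2 * (exp (2*y) - 1)) \<le> (2*y)\<^sup>2 / 8"
      using Hoeffdings_lemma_aux[of "2*y" "1/2"] that by simp
    then have "ln (exp y * cosh y) \<le> y + y\<^sup>2 / 2"
      unfolding eq by (simp add: power_mult_distrib)
    then have "ln (cosh y) \<le> y\<^sup>2 / 2"
      by (simp add: ln_mult)
    then show ?thesis
      by (metis cosh_real_pos exp_le_cancel_iff exp_ln)
  qed
  show ?thesis
    using *[of x] *[of "-x"] by (cases "x \<ge> 0") auto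
qed

text \<open>The sub-Gaussian bound for a random signing, with the expectation replaced by a sum over
  all \<open>2 ^ card S\<close> signings. The exponential factors over the coordinates, and each
  factor is a \<open>cosh\<close>.\<close>

lemma sum_exp_signs_le:
  fixes a :: "'a \<Rightarrow> real"
  assumes "finite S"
  shows "(\<Sum>x\<in>S \<rightarrow>\<^sub>E {-1, 1}. exp (\<Sum>j\<in>S. a j * x j)) \<le> 2 ^ card S * exp ((\<Sum>j\<in>S. (a j)\<^sup>2) / 2)"
proof -
  have "(\<Sum>x\<in>S \<rightarrow>\<^sub>E {-1, 1}. exp (\<Sum>j\<in>S. a j * x j)) = (\<Sum>x\<in>S \<rightarrow>\<^sub>E {-1, 1}. \<Prod>j\<in>S. exp (a j * x j))"
    using assms by (simp add: exp_sum)
  also have "\<dots> = (\<Prod>j\<in>S. \<Sum>s\<in>{-1, 1}. exp (a j * s))"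
    using assms by (subst prod_sum_PiE) auto
  also have "\<dots> = (\<Prod>j\<in>S. 2 * cosh (a j))"
    by (intro prod.cong refl) (simp add: cosh_field_def)
  also have "\<dots> \<le> (\<Prod>j\<in>S. 2 * exp ((a j)\<^sup>2 / 2))"
    by (intro prod_mono) (auto simp: cosh_le_exp_half_square)
  also have "\<dots> = 2 ^ card S * exp ((\<Sum>j\<in>S. (a j)\<^sup>2) / 2)"
    using assms by (simp add: prod.distrib exp_sum sum_divide_distrib)
  finally show ?thesis .
qed

lemma sum_cosh_signs_le:
  fixes a :: "'a \<Rightarrow> real"
  assumes "finite S"
  shows "(\<Sum>x\<in>S \<rightarrow>\<^sub>E {-1, 1}. cosh (t * (\<Sum>j\<in>S. a j * x j)))
    \<le> 2 ^ card S * exp (t\<^sup>2 * (\<Sum>j\<in>S. (a j)\<^sup>2) / 2)"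
proof -
  have *: "(\<Sum>x\<in>S \<rightarrow>\<^sub>E {-1, 1}. exp (s * (\<Sum>j\<in>S. a j * x j)))
    \<le> 2 ^ card S * exp (s\<^sup>2 * (\<Sum>j\<in>S. (a j)\<^sup>2) / 2)" for s
    using sum_exp_signs_le[OF assms, of "\<lambda>j. s * a j"]
    by (simp add: sum_distrib_left power_mult_distrib mult.assoc)
  show ?thesis
    using *[of t] *[of "-t"] by (simp add: cosh_field_def sum.distrib flip: sum_divide_distrib)
qed

text \<open>A nonzero rounding forces \<open>\<bar>u\<bar> \<ge> 1/2\<close>, and then its size is
  at most \<open>1 + (\<bar>u\<bar> - 1/2)\<close>, which the exponential dominates. The free
  parameter \<open>T\<close> is later tuned against the sub-Gaussian bound.\<close>

lemma abs_round_le_cosh: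
  fixes u T :: real
  assumes "T \<ge> 1"
  shows "\<bar>of_int (round u)\<bar> \<le> 2 * exp (- T / 2) * cosh (T * u)"
proof (cases "round u = 0")
  case False
  have r: "\<bar>of_int (round u) - u\<bar> \<le> 1/2"
    using of_int_round_abs_le[of u] by simp
  then have u: "\<bar>u\<bar> \<ge> 1/2"
    using False by linarith
  have "\<bar>of_int (round u)\<bar> \<le> 1 + (\<bar>u\<bar> - 1/2)"
    using r by linarith
  also have "\<dots> \<le> 1 + T * (\<bar>u\<bar> - 1/2)"
    using u mult_right_mono[OF assms, of "\<bar>u\<bar> - 1/2"] by simp
  also have "\<dots> \<le> exp (T * (\<bar>u\<bar> - 1/2))"
    by (rule exp_ge_add_one_self)
  also have "\<dots> = exp (- T / 2) * exp (T * \<bar>u\<bar>)"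
    by (simp add: algebra_simps flip: exp_add)
  also have "exp (T * \<bar>u\<bar>) \<le> 2 * cosh (T * u)"
    by (cases "u \<ge> 0") (simp_all add: cosh_field_def)
  finally show ?thesis
    by (simp add: algebra_simps)
qed (simp add: cosh_real_nonneg)

text \<open>A two-sided geometric series in z = \<open>exp (- l)\<close>; as z \<le> 1/3, the tails
  2z/(1 - z) amount to at most 3z, uniformly in \<open>L\<close>.\<close>

lemma sum_exp_abs_int_le:
  fixes l :: real
  assumes "l \<ge> ln 3"
  shows "(\<Sum>b\<in>{-int L..int L}. exp (- l * \<bar>of_int b\<bar>)) \<le> exp (3 * exp (- l))"
proof -
  define z where "z = exp (- l)"
  have "exp (- l) \<le> exp (- ln 3)"
    using assms by simp
  then have z: "0 < z" "z \<le> 1/3"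
    by (auto simp: z_def exp_minus)
  \<comment> \<open>The subtracted term strengthens the claim so that the induction closes: the step
    needs exactly 3z \<le> 1.\<close>
  have *: "(\<Sum>b\<in>{-int L..int L}. exp (- l * \<bar>of_int b\<bar>)) \<le> 1 + 3 * z - 3 * z ^ Suc L"
  proof (induction L)
    case (Suc L)
    have eq: "{-int (Suc L)..int (Suc L)} = insert (- int (Suc L)) (insert (int (Suc L)) {-int L..int L})"
      by auto
    have e: "exp (- l * (1 + real L)) = z ^ Suc L"
      unfolding z_def exp_of_nat_mult[symmetric] by (simp add: algebra_simps)
    have "2 * z ^ Suc L \<le> 3 * z ^ Suc L - 3 * z ^ Suc (Suc L)"
      using z by (simp add: algebra_simps)
    then show ?case
      using Suc.IH e unfolding eq by (simp add: algebra_simps)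
  qed simp
  also have "\<dots> \<le> 1 + 3 * z"
    using z by simp
  also have "\<dots> \<le> exp (3 * z)"
    by (rule exp_ge_add_one_self)
  finally show ?thesis
    by (simp add: z_def)
qed

text \<open>In each coordinate one sign agrees with \<open>x\<close> and the other does not, so the
  generating function of the distance factors. For y < 1 it limits how many signings lie close to
  \<open>x\<close>.\<close>

lemma sum_hamming_weight:
  fixes y :: real
  assumes "finite S" "x \<in> S \<rightarrow>\<^sub>E {-1, 1::real}"
  shows "(\<Sum>x'\<in>S \<rightarrow>\<^sub>E {-1, 1}. y ^ card {j\<in>S. x' j \<noteq> x j}) = (1 + y) ^ card S"
proof -
  have "y ^ card {j\<in>S. x' j \<noteq> x j} = (\<Prod>j\<in>S. if x' j \<noteq> x j then y else 1)" for x'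
    using assms(1) by (simp add: prod.If_cases Int_def)
  then have "(\<Sum>x'\<in>S \<rightarrow>\<^sub>E {-1, 1}. y ^ card {j\<in>S. x' j \<noteq> x j})
    = (\<Sum>x'\<in>S \<rightarrow>\<^sub>E {-1, 1}. \<Prod>j\<in>S. if x' j \<noteq> x j then y else 1)"
    by simp
  also have "\<dots> = (\<Prod>j\<in>S. \<Sum>s\<in>{-1, 1}. if s \<noteq> x j then y else 1)"
    using assms(1) by (subst prod_sum_PiE) auto
  also have "\<dots> = (\<Prod>j\<in>S. 1 + y)"
    using assms(2) by (intro prod.cong refl) (auto dest!: PiE_mem)
  finally show ?thesis
    by simp
qed

text \<open>Jensen's inequality, from the tangent of the exponential at \<open>\<mu>\<close>. An
  upper bound on the mean suffices because the function decreases for l \<ge> 0.\<close>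

lemma exp_mean_le_mean_exp:
  fixes w :: "'a \<Rightarrow> real" and \<mu> l :: real
  assumes "finite X" "(\<Sum>x\<in>X. w x) \<le> card X * \<mu>" "l \<ge> 0"
  shows "card X * exp (- l * \<mu>) \<le> (\<Sum>x\<in>X. exp (- l * w x))"
proof -
  have "exp (- l * \<mu>) * (1 + l * (\<mu> - w x)) \<le> exp (- l * w x)" for x
  proof -
    have "exp (- l * \<mu>) * (1 + l * (\<mu> - w x)) \<le> exp (- l * \<mu>) * exp (l * (\<mu> - w x))"
      by (intro mult_left_mono exp_ge_add_one_self) auto
    then show ?thesis
      by (simp add: algebra_simps flip: exp_add)
  qed
  then have "(\<Sum>x\<in>X. exp (- l * \<mu>) * (1 + l * (\<mu> - w x))) \<le> (\<Sum>x\<in>X. exp (- l * w x))"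
    by (intro sum_mono)
  moreover have "(\<Sum>x\<in>X. exp (- l * \<mu>) * (1 + l * (\<mu> - w x)))
      = exp (- l * \<mu>) * (card X + l * (card X * \<mu> - (\<Sum>x\<in>X. w x)))"
    by (simp add: sum.distrib sum_subtractf flip: sum_distrib_left)
  moreover have "exp (- l * \<mu>) * card X \<le> exp (- l * \<mu>) * (card X + l * (card X * \<mu> - (\<Sum>x\<in>X. w x)))"
    using assms by (intro mult_left_mono) auto
  ultimately show ?thesis
    by (simp only: mult.commute[of "real (card X)" "exp (- l * \<mu>)"])
qed

section \<open>Partial colouring by pigeonhole\<close>

lemma partial_coloring:
  fixes a :: "nat \<Rightarrow> 'a \<Rightarrow> real" and \<sigma> :: real
  assumes S: "finite S" "S \<noteq> {}" "card S \<le> m"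
    and \<sigma>: "\<sigma> > 0" "\<And>i. i < m \<Longrightarrow> (\<Sum>j\<in>S. (a i j)\<^sup>2) \<le> \<sigma>\<^sup>2"
  shows "\<exists>x. (\<forall>j\<in>S. x j \<in> {-1, 0, 1}) \<and> card S < 4 * card {j\<in>S. x j \<noteq> 0} \<and>
    (\<forall>i<m. \<bar>\<Sum>j\<in>S. a i j * x j\<bar> \<le> 2 * \<sigma> * sqrt (ln (100 * real m / card S)))"
proof -
  define k where "k = card S"
  define l where "l = ln (100 * real m / k)"
  define \<Delta> where "\<Delta> = 2 * \<sigma> * sqrt l"
  define X where "X = S \<rightarrow>\<^sub>E {-1, 1::real}"
  \<comment> \<open>The scale is twice the permitted error \<open>\<Delta>\<close>: two signings
    with equal roundings have values of \<open>u\<close> at most 1 apart, so half their difference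
    has row sums at most \<open>\<Delta>\<close>.\<close>
  define u where "u i x = (\<Sum>j\<in>S. a i j * x j) / (2 * \<Delta>)" for i x
  define b where "b x = (\<lambda>i\<in>{..<m}. round (u i x))" for x
  define w where "w x = (\<Sum>i<m. \<bar>real_of_int (b x i)\<bar>)" for x
  have k: "0 < k" "k \<le> m"
    using S by (auto simp: k_def card_gt_0_iff)
  have ratio: "100 \<le> 100 * real m / k"
    using k by (simp add: field_simps)
  have z: "exp (- l) = k / (100 * real m)"
    using k by (simp add: l_def exp_minus)
  have l_ge: "l \<ge> ln 100"
    unfolding l_def using ratio by (subst ln_le_cancel_iff) linarith+
  moreover have "ln 100 \<ge> (1 :: real)"
    using exp_le by (subst ln_ge_iff) auto
  ultimately have l1: "l \<ge> 1"
    by simp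
  have \<Delta>: "\<Delta> > 0"
    using \<sigma> l1 by (simp add: \<Delta>_def)
  have finX: "finite X" and cardX: "card X = 2 ^ k"
    using S by (auto simp: X_def k_def card_PiE numeral_2_eq_2 intro!: finite_PiE)
  have mean_i: "(\<Sum>x\<in>X. \<bar>real_of_int (b x i)\<bar>) \<le> 2 ^ k * (2 * exp (- l) ^ 2)" if i: "i < m" for i
  proof -
    \<comment> \<open>The choice T = 8l minimises the resulting exponent -T/2 + T^2/(32 l), whose
      minimum is -2l.\<close>
    have "(\<Sum>x\<in>X. \<bar>real_of_int (b x i)\<bar>) \<le> (\<Sum>x\<in>X. 2 * exp (- (8 * l) / 2) * cosh ((8 * l) * u i x))"
      unfolding b_def using i l1 by (intro sum_mono) (simp only: restrict_apply' lessThan_iff, intro abs_round_le_cosh, simp)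
    also have "\<dots> = 2 * exp (- 4 * l) * (\<Sum>x\<in>X. cosh ((4 * l / \<Delta>) * (\<Sum>j\<in>S. a i j * x j)))"
      by (simp add: u_def mult.assoc flip: sum_distrib_left)
    also have "\<dots> \<le> 2 * exp (- 4 * l) * (2 ^ k * exp ((4 * l / \<Delta>)\<^sup>2 * (\<Sum>j\<in>S. (a i j)\<^sup>2) / 2))"
      unfolding X_def k_def by (intro mult_left_mono sum_cosh_signs_le S) auto
    also have "\<dots> \<le> 2 * exp (- 4 * l) * (2 ^ k * exp ((4 * l / \<Delta>)\<^sup>2 * \<sigma>\<^sup>2 / 2))"
      by (intro mult_left_mono iffD2[OF exp_le_cancel_iff] divide_right_mono \<sigma> i) auto
    also have "(4 * l / \<Delta>)\<^sup>2 * \<sigma>\<^sup>2 / 2 = 2 * l"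
      using \<sigma> l1 by (simp add: \<Delta>_def power_mult_distrib power_divide field_simps power2_eq_square)
    also have "2 * exp (- 4 * l) * (2 ^ k * exp (2 * l)) = 2 ^ k * (2 * exp (- l) ^ 2)"
      by (simp add: power2_eq_square flip: exp_add)
    finally show ?thesis .
  qed
  have "(\<Sum>x\<in>X. w x) = (\<Sum>i<m. \<Sum>x\<in>X. \<bar>real_of_int (b x i)\<bar>)"
    unfolding w_def by (rule sum.swap)
  also have "\<dots> \<le> (\<Sum>i<m. 2 ^ k * (2 * exp (- l) ^ 2))"
    by (intro sum_mono mean_i) auto
  also have "\<dots> = card X * (2 * m * exp (- l) ^ 2)"
    by (simp add: cardX)
  finally have "(\<Sum>x\<in>X. w x) \<le> card X * (2 * m * exp (- l) ^ 2)" .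
  then have "card X * exp (- l * (2 * m * exp (- l) ^ 2)) \<le> (\<Sum>x\<in>X. exp (- l * w x))"
    using finX l1 by (intro exp_mean_le_mean_exp) auto
  \<comment> \<open>The mean weight is at most 2m exp(-2l). One factor exp(-l) absorbs l, and the
    other turns 2m into k/50.\<close>
  moreover have "exp (- real k / 50) \<le> exp (- l * (2 * m * exp (- l) ^ 2))"
  proof -
    have "l \<le> exp l"
      using exp_ge_add_one_self[of l] by linarith
    then have "l * exp (- l) \<le> exp l * exp (- l)"
      by (intro mult_right_mono) auto
    then have "(l * exp (- l)) * (2 * m * exp (- l)) \<le> 1 * (2 * m * exp (- l))"
      by (intro mult_right_mono) (auto simp flip: exp_add)
    also have "\<dots> = k / 50"
      using k by (simp add: z)
    finally show ?thesis
      by (simp add: power2_eq_square mult_ac)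
  qed
  then have "card X * exp (- real k / 50) \<le> card X * exp (- l * (2 * m * exp (- l) ^ 2))"
    by (intro mult_left_mono) auto
  ultimately have "card X * exp (- real k / 50) \<le> (\<Sum>x\<in>X. exp (- l * w x))"
    by linarith
  then have lower: "2 ^ k * exp (- real k / 50) \<le> (\<Sum>x\<in>X. exp (- l * w x))"
    by (simp add: cardX)

  \<comment> \<open>Next comes the upper bound on the same weighted sum: grouping signings by their
    rounded vector leaves at most \<open>N\<close>, the largest fibre size, times the total weight
    of all vectors.\<close>
  define fib where "fib c = {x\<in>X. b x = c}" for c
  define N where "N = Max ((\<lambda>c. card (fib c)) ` b ` X)"
  have "X \<noteq> {}"
    using cardX by auto
  then have "N \<in> (\<lambda>c. card (fib c)) ` b ` X"
    unfolding N_def using finX by (intro Max_in) auto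
  then obtain c where c: "card (fib c) = N"
    by auto
  have N_ge: "card (fib c) \<le> N" if "c \<in> b ` X" for c
    unfolding N_def using finX that by (intro Max_ge) auto
  define L where "L = Max ((\<lambda>(x, i). nat \<bar>b x i\<bar>) ` (X \<times> {..<m}))"
  have L: "\<bar>b x i\<bar> \<le> int L" if "x \<in> X" "i < m" for x i
  proof -
    have "nat \<bar>b x i\<bar> \<le> L"
      unfolding L_def using finX that by (intro Max_ge) (auto intro!: image_eqI[of _ _ "(x, i)"])
    then show ?thesis
      by linarith
  qed
  \<comment> \<open>Enlarging the set of attained vectors to a full box makes the total weight a
    product over the rows.\<close>
  define Q where "Q = {..<m} \<rightarrow>\<^sub>E {-int L..int L}"
  have Q: "b ` X \<subseteq> Q"
  proof (safe)
    fix x assume "x \<in> X"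
    then show "b x \<in> Q"
      unfolding Q_def using L[of x] by (intro PiE_I) (auto simp: b_def abs_le_iff minus_le_iff)
  qed
  have finQ: "finite Q"
    by (auto simp: Q_def intro!: finite_PiE)
  have "(\<Sum>x\<in>X. exp (- l * w x)) = (\<Sum>c\<in>b ` X. \<Sum>x\<in>fib c. exp (- l * w x))"
    unfolding fib_def using finX by (rule sum.image_gen)
  also have "\<dots> = (\<Sum>c\<in>b ` X. card (fib c) * exp (- l * (\<Sum>i<m. \<bar>real_of_int (c i)\<bar>)))"
    by (intro sum.cong refl) (simp add: fib_def w_def)
  also have "\<dots> \<le> (\<Sum>c\<in>b ` X. N * exp (- l * (\<Sum>i<m. \<bar>real_of_int (c i)\<bar>)))"
    using N_ge by (intro sum_mono mult_right_mono) auto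
  also have "\<dots> \<le> (\<Sum>c\<in>Q. N * exp (- l * (\<Sum>i<m. \<bar>real_of_int (c i)\<bar>)))"
    using Q finQ by (intro sum_mono2) auto
  also have "\<dots> = N * (\<Sum>c\<in>Q. \<Prod>i<m. exp (- l * \<bar>real_of_int (c i)\<bar>))"
    by (simp add: sum_distrib_left exp_sum flip: sum_negf)
  also have "\<dots> = N * (\<Prod>i<m. \<Sum>d\<in>{-int L..int L}. exp (- l * \<bar>real_of_int d\<bar>))"
    unfolding Q_def by (subst prod_sum_PiE) auto
  also have "\<dots> \<le> N * (\<Prod>i<m. exp (3 * exp (- l)))"
    using l_ge by (intro mult_left_mono prod_mono conjI sum_exp_abs_int_le sum_nonneg) 
      (auto intro: order_trans[OF _ l_ge])
  also have "\<dots> = N * exp (3 * k / 100)"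
    using k by (simp add: z flip: exp_of_nat_mult)
  finally have "2 ^ k * exp (- real k / 50) \<le> N * exp (3 * k / 100)"
    using lower by simp
  then have "2 ^ k * exp (- real k / 50) * exp (- 3 * k / 100) \<le> N * exp (3 * k / 100) * exp (- 3 * k / 100)"
    by (intro mult_right_mono) auto
  then have "2 ^ k * exp (k * (-1 / 20)) \<le> N"
    by (simp add: mult.assoc flip: exp_add)
  \<comment> \<open>The losses k/50 and 3k/100 add up to k/20, and exp(-1/20) \<ge> 19/20; doubling
    gives the base 19/10.\<close>
  moreover have "(19/20::real) ^ k \<le> exp (-1/20) ^ k"
    using exp_ge_add_one_self[of "-1/20"] by (intro power_mono) auto
  then have "2 ^ k * (19/20::real) ^ k \<le> 2 ^ k * exp (k * (-1 / 20))"
    unfolding exp_of_nat_mult by (intro mult_left_mono) auto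
  ultimately have N: "(19/10) ^ k \<le> real N"
    by (simp flip: power_mult_distrib)

  have "fib c \<noteq> {}"
    using N c by (metis card.empty of_nat_0 not_less zero_less_divide_iff zero_less_numeral zero_less_power)
  then obtain x where x: "x \<in> fib c"
    by auto
  have "\<exists>x'\<in>fib c. k < 4 * card {j\<in>S. x' j \<noteq> x j}"
  proof (rule ccontr)
    assume "\<not> ?thesis"
    then have le: "4 * card {j\<in>S. x' j \<noteq> x j} \<le> k" if "x' \<in> fib c" for x'
      using that by (auto simp: not_less)
    \<comment> \<open>If the whole fibre were within distance k/4 of \<open>x\<close>, weighting
      distance d by (3/4)^(4d) would give N (3/4)^k \<le> (1 + 81/256)^k. This contradicts N \<ge>
      (19/10)^k, since (19/10)(3/4) = 57/40 exceeds 337/256.\<close>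
    have "(\<Sum>x'\<in>fib c. (3/4::real) ^ k) \<le> (\<Sum>x'\<in>fib c. (3/4) ^ (4 * card {j\<in>S. x' j \<noteq> x j}))"
      using le by (intro sum_mono power_decreasing) auto
    also have "\<dots> \<le> (\<Sum>x'\<in>X. (3/4) ^ (4 * card {j\<in>S. x' j \<noteq> x j}))"
      using finX by (intro sum_mono2) (auto simp: fib_def)
    also have "\<dots> = (\<Sum>x'\<in>X. (81/256) ^ card {j\<in>S. x' j \<noteq> x j})"
      by (simp add: power_mult power_divide)
    also have "\<dots> = (1 + 81/256) ^ k"
      unfolding X_def k_def using x S by (intro sum_hamming_weight) (auto simp: fib_def X_def)
    finally have "N * (3/4) ^ k \<le> (337/256::real) ^ k"
      by (simp add: c)
    moreover have "(19/10) ^ k * (3/4::real) ^ k \<le> N * (3/4) ^ k"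
      using N by (intro mult_right_mono) auto
    moreover have "(337/256::real) ^ k < (57/40) ^ k"
      using k by (intro power_strict_mono) auto
    ultimately show False
      by (simp flip: power_mult_distrib)
  qed
  then obtain x' where x': "x' \<in> fib c" "k < 4 * card {j\<in>S. x' j \<noteq> x j}"
    by blast
  have sgn: "x j \<in> {-1, 1}" "x' j \<in> {-1, 1}" if "j \<in> S" for j
    using x x' that by (auto simp: fib_def X_def dest!: PiE_mem)
  show ?thesis
  proof (intro exI[of _ "\<lambda>j. (x' j - x j) / 2"] conjI ballI allI impI)
    show "(x' j - x j) / 2 \<in> {-1, 0, 1}" if "j \<in> S" for j
      using sgn[OF that] by auto
    have "{j\<in>S. (x' j - x j) / 2 \<noteq> 0} = {j\<in>S. x' j \<noteq> x j}"
      by auto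
    then show "card S < 4 * card {j\<in>S. (x' j - x j) / 2 \<noteq> 0}"
      using x' by (simp add: k_def)
    fix i assume i: "i < m"
    have "b x i = b x' i"
      using x x' by (simp add: fib_def)
    then have "round (u i x) = round (u i x')"
      using i by (simp add: b_def)
    then have "\<bar>u i x' - u i x\<bar> \<le> 1"
      using of_int_round_abs_le[of "u i x"] of_int_round_abs_le[of "u i x'"] by linarith
    then have "\<Delta> * \<bar>u i x' - u i x\<bar> \<le> \<Delta> * 1"
      using \<Delta> by (intro mult_left_mono) auto
    moreover have "(\<Sum>j\<in>S. a i j * ((x' j - x j) / 2)) = \<Delta> * (u i x' - u i x)"
      using \<Delta> by (simp add: u_def right_diff_distrib diff_divide_distrib sum_subtractf flip: sum_divide_distrib)
    ultimately have "\<bar>\<Sum>j\<in>S. a i j * ((x' j - x j) / 2)\<bar> \<le> \<Delta>"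
      using \<Delta> by (simp only: abs_mult abs_of_pos mult_1_right)
    then show "\<bar>\<Sum>j\<in>S. a i j * ((x' j - x j) / 2)\<bar> \<le> 2 * \<sigma> * sqrt (ln (100 * real m / card S))"
      by (simp add: \<Delta>_def l_def k_def)
  qed
qed

section \<open>From partial to full colourings\<close>

text \<open>The row bound is assumed for every subset, so it passes to the columns still unsigned.
  With q the fourth root of k/m, one partial colouring costs 32 \<open>sqrt B\<close> q and q then
  shrinks by a factor of at most 15/16; the constant is 512 = 32/(1 - 15/16).\<close>

lemma full_coloring:
  fixes a :: "nat \<Rightarrow> 'a \<Rightarrow> real" and B :: real
  assumes "finite S" "card S \<le> m" and B: "B > 0"
    and "\<And>i T. i < m \<Longrightarrow> T \<subseteq> S \<Longrightarrow>
      (\<Sum>j\<in>T. (a i j)\<^sup>2) \<le> B * (card T / m) * ln (100 * real m / card T)"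
  shows "\<exists>x. (\<forall>j\<in>S. x j \<in> {-1, 1}) \<and>
    (\<forall>i<m. \<bar>\<Sum>j\<in>S. a i j * x j\<bar> \<le> 512 * sqrt B * root 4 (card S / m))"
  using assms(1,2,4)
proof (induction rule: finite_psubset_induct)
  case (psubset S)
  show ?case
  proof (cases "S = {}")
    case False
    define k where "k = card S"
    define q where "q = root 4 (k / m)"
    define l where "l = ln (100 * real m / k)"
    define \<sigma> where "\<sigma> = sqrt (B * (k / m) * l)"
    have k: "0 < k" "k \<le> m"
      using False psubset by (auto simp: k_def card_gt_0_iff)
    have q: "q > 0" "q ^ 4 = k / m"
      using k by (auto simp: q_def)
    have "100 \<le> 100 * real m / k"
      using k by (simp add: field_simps)
    then have l: "l > 0"
      unfolding l_def by (intro ln_gt_zero) linarith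
    have \<sigma>: "\<sigma> > 0"
      using B k l by (simp add: \<sigma>_def)
    have "\<exists>y. (\<forall>j\<in>S. y j \<in> {-1, 0, 1}) \<and> card S < 4 * card {j\<in>S. y j \<noteq> 0} \<and>
      (\<forall>i<m. \<bar>\<Sum>j\<in>S. a i j * y j\<bar> \<le> 2 * \<sigma> * sqrt (ln (100 * real m / card S)))"
    proof (rule partial_coloring)
      fix i assume "i < m"
      then show "(\<Sum>j\<in>S. (a i j)\<^sup>2) \<le> \<sigma>\<^sup>2"
        using psubset.prems(2)[of i S] B l by (simp add: \<sigma>_def k_def l_def)
    qed (use psubset False \<sigma> in auto)
    then obtain y where y: "\<And>j. j \<in> S \<Longrightarrow> y j \<in> {-1, 0, 1}" "k < 4 * card {j\<in>S. y j \<noteq> 0}"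
      "\<And>i. i < m \<Longrightarrow> \<bar>\<Sum>j\<in>S. a i j * y j\<bar> \<le> 2 * \<sigma> * sqrt l"
      by (auto simp: k_def l_def)
    define T where "T = {j\<in>S. y j = 0}"
    have "card {j\<in>S. y j \<noteq> 0} + card T = card ({j\<in>S. y j \<noteq> 0} \<union> T)"
      using psubset by (intro card_Un_disjoint[symmetric]) (auto simp: T_def)
    also have "{j\<in>S. y j \<noteq> 0} \<union> T = S"
      by (auto simp: T_def)
    finally have T: "4 * card T < 3 * k"
      using y(2) by (simp add: k_def)
    then have "T \<subset> S"
      using k by (auto simp: T_def k_def)
    moreover have "card T \<le> m"
      using T k by linarith
    moreover have "(\<Sum>j\<in>R. (a i j)\<^sup>2) \<le> B * (card R / m) * ln (100 * real m / card R)"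
      if "i < m" "R \<subseteq> T" for i R
      using that \<open>T \<subset> S\<close> by (intro psubset.prems(2)) auto
    ultimately have "\<exists>x. (\<forall>j\<in>T. x j \<in> {-1, 1}) \<and>
        (\<forall>i<m. \<bar>\<Sum>j\<in>T. a i j * x j\<bar> \<le> 512 * sqrt B * root 4 (card T / m))"
      by (rule psubset.IH)
    then obtain x where x: "\<And>j. j \<in> T \<Longrightarrow> x j \<in> {-1, 1}"
      "\<And>i. i < m \<Longrightarrow> \<bar>\<Sum>j\<in>T. a i j * x j\<bar> \<le> 512 * sqrt B * root 4 (card T / m)"
      by blast

    \<comment> \<open>As 100 \<le> 4^4, the logarithm is at most 4 ln(4/q) \<le> 16/q. The error is
      of order q^2 l, so trading the logarithm for one power of q leaves order q.\<close>
    have "l \<le> ln ((4 / q) ^ 4)"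
      unfolding l_def using k q by (intro ln_mono) (auto simp: power_divide field_simps)
    also have "\<dots> = 4 * ln (4 / q)"
      using q by (subst ln_realpow) auto
    also have "\<dots> \<le> 16 / q"
      using ln_bound[of "4 / q"] q by simp
    finally have "l \<le> 16 / q" .
    have "2 * \<sigma> * sqrt l = 2 * sqrt B * sqrt (k / m) * (sqrt l * sqrt l)"
      unfolding \<sigma>_def real_sqrt_mult by (simp only: mult_ac)
    also have "\<dots> = 2 * sqrt B * sqrt (q ^ 4) * l"
      using l by (simp add: q)
    also have "sqrt (q ^ 4) = q\<^sup>2"
      using real_sqrt_abs[of "q\<^sup>2"] by (simp flip: power_mult)
    also have "2 * sqrt B * q\<^sup>2 * l \<le> 2 * sqrt B * q\<^sup>2 * (16 / q)"
      using \<open>l \<le> 16 / q\<close> B by (intro mult_left_mono) auto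
    also have "\<dots> = 32 * sqrt B * q"
      using q by (simp add: power2_eq_square)
    finally have step: "2 * \<sigma> * sqrt l \<le> 32 * sqrt B * q" .

    \<comment> \<open>Fewer than 3/4 of the columns remain, and 3/4 \<le> (15/16)^4.\<close>
    have "root 4 (card T / m) \<le> root 4 ((15/16 * q) ^ 4)"
      using T k by (intro real_root_le_mono) (auto simp: q power_mult_distrib power_divide field_simps)
    also have "\<dots> = 15/16 * q"
      using q by (subst real_root_power_cancel) auto
    finally have "512 * sqrt B * root 4 (card T / m) \<le> 512 * sqrt B * (15/16 * q)"
      using B by (intro mult_left_mono) auto
    also have "\<dots> = 480 * sqrt B * q"
      by simp
    finally have rest: "\<bar>\<Sum>j\<in>T. a i j * x j\<bar> \<le> 480 * sqrt B * q" if "i < m" for i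
      using x(2)[OF that] by (rule order_trans[rotated])

    show ?thesis
    proof (intro exI[of _ "\<lambda>j. if j \<in> T then x j else y j"] conjI ballI allI impI)
      show "(if j \<in> T then x j else y j) \<in> {-1, 1}" if "j \<in> S" for j
        using x(1)[of j] y(1)[of j] that by (auto simp: T_def)
      fix i assume i: "i < m"
      have "(\<Sum>j\<in>S. a i j * (if j \<in> T then x j else y j))
        = (\<Sum>j\<in>S. a i j * y j + (if j \<in> T then a i j * x j else 0))"
        by (intro sum.cong) (auto simp: T_def)
      also have "\<dots> = (\<Sum>j\<in>S. a i j * y j) + (\<Sum>j\<in>T. a i j * x j)"
        using psubset \<open>T \<subset> S\<close> by (simp add: sum.distrib Int_absorb1 flip: sum.inter_restrict)
      finally show "\<bar>\<Sum>j\<in>S. a i j * (if j \<in> T then x j else y j)\<bar> \<le> 512 * sqrt B * root 4 (card S / m)"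
        using y(3)[OF i] rest[OF i] step unfolding k_def[symmetric] q_def[symmetric] by linarith
    qed
  qed simp
qed

lemma disc_le:
  assumes x: "\<And>j. j < n \<Longrightarrow> x j \<in> {-1, 1}" and "m > 0"
    and le: "\<And>i. i < m \<Longrightarrow> \<bar>\<Sum>j<n. A i j * x j\<bar> \<le> c"
  shows "disc m n A \<le> c"
proof -
  \<comment> \<open>The minimum in \<open>disc\<close> is over extensional functions.\<close>
  define y where "y = restrict x {..<n}"
  have "disc m n A \<le> sup_norm m (mat_vec n A y)"
    unfolding disc_def using x by (intro Min_le) (auto simp: y_def intro!: finite_PiE imageI)
  also have "\<dots> \<le> c"
    unfolding sup_norm_def using le \<open>m > 0\<close> by (intro Max.boundedI) (auto simp: mat_vec_def y_def)
  finally show ?thesis .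
qed

section \<open>One coordinate of a uniform point of the ball\<close>

text \<open>Fubini: the slice of the ball at height t is a ball of dimension m - 1 and radius
  \<open>sqrt (1 - t\<^sup>2)\<close>. A general \<open>h\<close> serves both the volume comparison
  (h = 1) and the exponential moment.\<close>

lemma nn_integral_unit_ball_component:
  fixes h :: "real \<Rightarrow> ennreal"
  assumes "i < m" and h[measurable]: "h \<in> borel_measurable borel"
  shows "(\<integral>\<^sup>+x. h (x i) * indicator (unit_ball m) x \<partial>lborel_vec m) =
    (\<integral>\<^sup>+t. h t * (ennreal (unit_ball_vol (real (m - 1)) * sqrt (1 - t\<^sup>2) ^ (m - 1))
      * indicator {-1<..<1} t) \<partial>lborel)"
proof -
  interpret product_sigma_finite "\<lambda>_. lborel :: real measure" ..
  define I where "I = {..<m} - {i}"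
  have I: "finite I" "i \<notin> I" "insert i I = {..<m}" "card I = m - 1"
    using assms by (auto simp: I_def)
  define B where "B t = {y \<in> space (Pi\<^sub>M I (\<lambda>_. lborel)). (\<Sum>j\<in>I. (y j)\<^sup>2) \<le> 1 - t\<^sup>2}" for t :: real
  have B: "B t \<in> sets (Pi\<^sub>M I (\<lambda>_. lborel))" for t
    unfolding B_def by measurable
  have i[measurable]: "(\<lambda>x. x i) \<in> borel_measurable (lborel_vec m)"
    using measurable_component_singleton[of i "{..<m}" "\<lambda>_. lborel :: real measure"] assms by simp
  have [measurable]: "(\<lambda>x. h (x i) * indicator (unit_ball m) x) \<in> borel_measurable (lborel_vec m)"
    by measurable
  have ind: "indicator (unit_ball m) (y(i := t)) = (indicator (B t) y :: ennreal)"
    if "y \<in> space (Pi\<^sub>M I (\<lambda>_. lborel :: real measure))" for y and t :: real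
  proof -
    have "(\<Sum>j\<in>{..<m}. ((y(i := t)) j)\<^sup>2) = t\<^sup>2 + (\<Sum>j\<in>I. (y j)\<^sup>2)"
      unfolding I(3)[symmetric] using I(1,2) by (subst sum.insert) (auto intro!: sum.cong)
    moreover have "y(i := t) \<in> space (lborel_vec m)"
      using that unfolding I(3)[symmetric] by (simp add: space_PiM PiE_fun_upd)
    ultimately show ?thesis
      using that by (auto simp: unit_ball_def B_def L2_set_def indicator_def algebra_simps)
  qed
  \<comment> \<open>At t = 1 and t = -1 the slice has radius zero; these heights form a null set and
    are left out.\<close>
  have vol: "emeasure (Pi\<^sub>M I (\<lambda>_. lborel)) (B t)
      = ennreal (unit_ball_vol (real (m - 1)) * sqrt (1 - t\<^sup>2) ^ (m - 1)) * indicator {-1<..<1} t"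
    if "t \<noteq> 1" "t \<noteq> -1" for t :: real
  proof (cases "t\<^sup>2 < 1")
    case True
    have "B t = {f. sqrt (\<Sum>j\<in>I. (f j)\<^sup>2) \<le> sqrt (1 - t\<^sup>2)} \<inter> space (Pi\<^sub>M I (\<lambda>_. lborel))"
      by (auto simp: B_def)
    then have "emeasure (Pi\<^sub>M I (\<lambda>_. lborel)) (B t)
        = ennreal (unit_ball_vol (real (m - 1)) * sqrt (1 - t\<^sup>2) ^ (m - 1))"
      using emeasure_cball_aux[of I "sqrt (1 - t\<^sup>2)"] I True by simp
    then show ?thesis
      using True by (simp add: abs_square_less_1 abs_less_iff)
  next
    case False
    then have "1 < t\<^sup>2"
      using that by (auto simp: not_less le_less power2_eq_1_iff)
    then have "\<not> (\<Sum>j\<in>I. (f j)\<^sup>2) \<le> 1 - t\<^sup>2" for f :: "nat \<Rightarrow> real"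
      using sum_nonneg[of I "\<lambda>j. (f j)\<^sup>2"] by (auto simp: not_le intro: less_le_trans)
    then have "B t = {}"
      by (auto simp: B_def)
    then show ?thesis
      using False abs_square_less_1[of t] by (auto simp: indicator_def abs_less_iff)
  qed
  have "(\<integral>\<^sup>+x. h (x i) * indicator (unit_ball m) x \<partial>lborel_vec m) =
    (\<integral>\<^sup>+t. \<integral>\<^sup>+y. h ((y(i := t)) i) * indicator (unit_ball m) (y(i := t)) \<partial>Pi\<^sub>M I (\<lambda>_. lborel) \<partial>lborel)"
    unfolding I(3)[symmetric] using I by (intro product_nn_integral_insert_rev) simp_all
  also have "\<dots> = (\<integral>\<^sup>+t. \<integral>\<^sup>+y. h t * indicator (B t) y \<partial>Pi\<^sub>M I (\<lambda>_. lborel) \<partial>lborel)"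
    by (intro nn_integral_cong) (simp add: ind)
  also have "\<dots> = (\<integral>\<^sup>+t. h t * emeasure (Pi\<^sub>M I (\<lambda>_. lborel)) (B t) \<partial>lborel)"
    using B by (simp add: nn_integral_cmult_indicator)
  also have "\<dots> = (\<integral>\<^sup>+t. h t * (ennreal (unit_ball_vol (real (m - 1)) * sqrt (1 - t\<^sup>2) ^ (m - 1))
      * indicator {-1<..<1} t) \<partial>lborel)"
  proof (rule nn_integral_cong_AE)
    have "AE t in lborel. t \<noteq> 1 \<and> t \<noteq> (-1 :: real)"
      by (simp add: AE_lborel_singleton)
    then show "AE t in lborel. h t * emeasure (Pi\<^sub>M I (\<lambda>_. lborel)) (B t)
      = h t * (ennreal (unit_ball_vol (real (m - 1)) * sqrt (1 - t\<^sup>2) ^ (m - 1)) * indicator {-1<..<1} t)"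
      by eventually_elim (simp add: vol)
  qed
  finally show ?thesis .
qed

lemma nn_integral_gaussian:
  fixes c :: real
  assumes "c > 0"
  shows "(\<integral>\<^sup>+t. exp (- c * t\<^sup>2) \<partial>lborel) = sqrt (pi / c)"
proof -
  \<comment> \<open>With variance 1/(2c) the integrand is a multiple of the normal density.\<close>
  define \<sigma> where "\<sigma> = sqrt (1 / (2 * c))"
  have \<sigma>: "\<sigma> > 0" "\<sigma>\<^sup>2 = 1 / (2 * c)"
    using assms by (auto simp: \<sigma>_def)
  have eq: "exp (- c * t\<^sup>2) = sqrt (pi / c) * normal_density 0 \<sigma> t" for t
    using assms by (simp add: normal_density_def \<sigma> real_sqrt_divide field_simps)
  have "(\<integral>\<^sup>+t. exp (- c * t\<^sup>2) \<partial>lborel) = (\<integral>\<^sup>+t. ennreal (sqrt (pi / c)) * normal_density 0 \<sigma> t \<partial>lborel)"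
    using assms unfolding eq by (intro nn_integral_cong) (simp add: ennreal_mult)
  also have "\<dots> = sqrt (pi / c) * (\<integral>\<^sup>+t. normal_density 0 \<sigma> t \<partial>lborel)"
    by (intro nn_integral_cmult) simp
  also have "(\<integral>\<^sup>+t. normal_density 0 \<sigma> t \<partial>lborel) = 1"
    using \<sigma> by (subst nn_integral_eq_integral) (auto intro: integrable_normal_density)
  finally show ?thesis
    by simp
qed

text \<open>The slab of heights at most 1/\<open>sqrt m\<close> in absolute value has width
  2/\<open>sqrt m\<close>, and each slice in it has at least half the volume of the central
  one.\<close>

lemma unit_ball_vol_ge:
  assumes "m \<ge> 2"
  shows "unit_ball_vol (real (m - 1)) / sqrt m \<le> unit_ball_vol (real m)"
proof -
  define V where "V = unit_ball_vol (real (m - 1))"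
  have V: "V > 0"
    by (simp add: V_def)
  define r where "r = 1 / sqrt m"
  have r: "0 < r" "r < 1" "r\<^sup>2 = 1 / m"
    using assms by (auto simp: r_def power_divide)
  have half: "1/2 \<le> sqrt (1 - t\<^sup>2) ^ (m - 1)" if "\<bar>t\<bar> \<le> r" for t
  proof -
    have "t\<^sup>2 \<le> 1 / m"
      using that r by (metis abs_ge_zero power2_abs power_mono)
    then have "1 - 1 / m \<le> 1 - t\<^sup>2"
      by simp
    \<comment> \<open>(1 - 1/m)^(m-1) is the reciprocal of (1 + 1/(m-1))^(m-1) \<le> e \<le> 4, so
      its square root is at least 1/2.\<close>
    have "(1 + 1 / (m - 1)) ^ (m - 1) \<le> exp (1 / (m - 1)) ^ (m - 1)"
      by (intro power_mono exp_ge_add_one_self) auto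
    also have "\<dots> = exp 1"
      using assms by (simp flip: exp_of_nat_mult)
    also have "\<dots> \<le> 4"
      using exp_le by simp
    finally have "(1 + 1 / (m - 1)) ^ (m - 1) \<le> 4" .
    moreover have "1 - 1 / m = inverse (1 + 1 / (m - 1))"
      using assms by (simp add: field_simps of_nat_diff)
    ultimately have "1/4 \<le> (1 - 1 / m) ^ (m - 1)"
      using assms by (simp add: power_inverse field_simps add_pos_nonneg)
    also have "\<dots> \<le> (1 - t\<^sup>2) ^ (m - 1)"
      using \<open>1 - 1 / m \<le> 1 - t\<^sup>2\<close> assms by (intro power_mono) auto
    finally have "sqrt (1/4) \<le> sqrt ((1 - t\<^sup>2) ^ (m - 1))"
      by (rule real_sqrt_le_mono)
    then show ?thesis
      by (simp add: real_sqrt_divide real_sqrt_power)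
  qed
  have "ennreal (V / sqrt m) = ennreal (V / 2) * ennreal (2 * r)"
    using V r by (simp add: r_def flip: ennreal_mult)
  also have "\<dots> = (\<integral>\<^sup>+t. ennreal (V / 2) * indicator {-r..r} t \<partial>lborel)"
    using r by (subst nn_integral_cmult_indicator) auto
  also have "\<dots> \<le> (\<integral>\<^sup>+t. 1 * (ennreal (V * sqrt (1 - t\<^sup>2) ^ (m - 1)) * indicator {-1<..<1} t) \<partial>lborel)"
  proof (intro nn_integral_mono)
    fix t :: real
    show "ennreal (V / 2) * indicator {-r..r} t \<le> 1 * (ennreal (V * sqrt (1 - t\<^sup>2) ^ (m - 1)) * indicator {-1<..<1} t)"
    proof (cases "t \<in> {-r..r}")
      case True
      then have "V * (1/2) \<le> V * sqrt (1 - t\<^sup>2) ^ (m - 1)"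
        using V half[of t] by (intro mult_left_mono) auto
      then show ?thesis
        using True r by (auto intro!: ennreal_leI)
    qed auto
  qed
  also have "\<dots> = (\<integral>\<^sup>+x. 1 * indicator (unit_ball m) x \<partial>lborel_vec m)"
    unfolding V_def using assms by (intro nn_integral_unit_ball_component[symmetric, of 0]) auto
  also have "\<dots> = emeasure (lborel_vec m) (unit_ball m)"
    by simp
  also have "\<dots> = ennreal (unit_ball_vol m)"
    by (rule emeasure_unit_ball)
  finally show ?thesis
    by (simp add: V_def)
qed

text \<open>For m \<ge> 2 the slice volume decays at least like exp(-m t^2/4). Spending half of that
  on the integrand leaves a Gaussian with integral \<open>sqrt (8 * pi / m)\<close>, at most
  6/\<open>sqrt m\<close>, and \<open>unit_ball_vol_ge\<close> cancels the
  \<open>sqrt m\<close>.\<close>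

lemma nn_integral_exp_square_uniform_ball:
  assumes "m \<ge> 2" "i < m"
  shows "(\<integral>\<^sup>+x. exp (m * (x i)\<^sup>2 / 8) \<partial>uniform_ball m) \<le> 6"
proof -
  define V where "V = unit_ball_vol (real (m - 1))"
  have V: "V > 0"
    by (simp add: V_def)
  have i[measurable]: "(\<lambda>x. x i) \<in> borel_measurable (lborel_vec m)"
    using measurable_component_singleton[of i "{..<m}" "\<lambda>_. lborel :: real measure"] assms by simp
  have "(\<integral>\<^sup>+x. ennreal (exp (m * (x i)\<^sup>2 / 8)) * indicator (unit_ball m) x \<partial>lborel_vec m)
    = (\<integral>\<^sup>+t. ennreal (exp (m * t\<^sup>2 / 8)) * (ennreal (V * sqrt (1 - t\<^sup>2) ^ (m - 1)) * indicator {-1<..<1} t) \<partial>lborel)"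
    unfolding V_def using assms by (intro nn_integral_unit_ball_component[where h = "\<lambda>t. ennreal (exp (m * t\<^sup>2 / 8))"]) auto
  also have "\<dots> \<le> (\<integral>\<^sup>+t. ennreal V * ennreal (exp (- (m / 8) * t\<^sup>2)) \<partial>lborel)"
  proof (intro nn_integral_mono)
    fix t :: real
    have "exp (m * t\<^sup>2 / 8) * (V * sqrt (1 - t\<^sup>2) ^ (m - 1)) \<le> V * exp (- (m / 8) * t\<^sup>2)" if "t \<in> {-1<..<1}"
    proof -
      have "t\<^sup>2 < 1"
        using that by (auto simp: abs_square_less_1)
      have "sqrt (1 - t\<^sup>2) \<le> sqrt (exp (- t\<^sup>2))"
        using exp_ge_add_one_self[of "- t\<^sup>2"] by (intro real_sqrt_le_mono) auto
      also have "\<dots> = exp (- t\<^sup>2 / 2)"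
        by (intro real_sqrt_unique) (simp_all flip: exp_double)
      finally have "sqrt (1 - t\<^sup>2) ^ (m - 1) \<le> exp (- t\<^sup>2 / 2) ^ (m - 1)"
        using \<open>t\<^sup>2 < 1\<close> by (intro power_mono) auto
      also have "\<dots> = exp (- (real (m - 1) / 2) * t\<^sup>2)"
        by (simp flip: exp_of_nat_mult)
      also have "\<dots> \<le> exp (- (m / 4) * t\<^sup>2)"
      proof -
        have "real m / 4 \<le> real (m - 1) / 2"
          using assms by (simp add: of_nat_diff)
        then show ?thesis
          using mult_right_mono[of "real m / 4" "real (m - 1) / 2" "t\<^sup>2"] by simp
      qed
      finally have "exp (m * t\<^sup>2 / 8) * (V * sqrt (1 - t\<^sup>2) ^ (m - 1))
          \<le> exp (m * t\<^sup>2 / 8) * (V * exp (- (m / 4) * t\<^sup>2))"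
        using V by (intro mult_left_mono) auto
      also have "\<dots> = V * (exp (m * t\<^sup>2 / 8) * exp (- (m / 4) * t\<^sup>2))"
        by simp
      also have "exp (m * t\<^sup>2 / 8) * exp (- (m / 4) * t\<^sup>2) = exp (- (m / 8) * t\<^sup>2)"
        unfolding exp_add[symmetric] by (simp add: field_simps)
      finally show ?thesis .
    qed
    then show "ennreal (exp (m * t\<^sup>2 / 8)) * (ennreal (V * sqrt (1 - t\<^sup>2) ^ (m - 1)) * indicator {-1<..<1} t)
      \<le> ennreal V * ennreal (exp (- (m / 8) * t\<^sup>2))"
      using V by (cases "t \<in> {-1<..<1}") (auto simp flip: ennreal_mult' intro!: ennreal_leI)
  qed
  also have "\<dots> = ennreal V * (\<integral>\<^sup>+t. ennreal (exp (- (m / 8) * t\<^sup>2)) \<partial>lborel)"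
    by (intro nn_integral_cmult) simp
  also have "\<dots> = ennreal V * ennreal (sqrt (pi / (m / 8)))"
    using assms by (subst nn_integral_gaussian) auto
  also have "\<dots> = ennreal (V * sqrt (pi / (m / 8)))"
    using V by (simp add: ennreal_mult')
  also have "\<dots> \<le> ennreal (6 * unit_ball_vol m)"
  proof (rule ennreal_leI)
    have "V * sqrt (pi / (m / 8)) = sqrt (8 * pi) * (V / sqrt m)"
      using assms by (simp add: real_sqrt_divide mult.commute)
    also have "\<dots> \<le> sqrt 36 * (V / sqrt m)"
      using V pi_less_4 by (intro mult_right_mono real_sqrt_le_mono) auto
    also have "\<dots> = 6 * (V / sqrt m)"
      using real_sqrt_abs[of 6] by simp
    also have "\<dots> \<le> 6 * unit_ball_vol m"
      using unit_ball_vol_ge[OF assms(1)] by (simp add: V_def)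
    finally show "V * sqrt (pi / (m / 8)) \<le> 6 * unit_ball_vol m" .
  qed
  finally have "(\<integral>\<^sup>+x. ennreal (exp (m * (x i)\<^sup>2 / 8)) * indicator (unit_ball m) x \<partial>lborel_vec m)
    \<le> ennreal (6 * unit_ball_vol m)" .
  then have "(\<integral>\<^sup>+x. exp (m * (x i)\<^sup>2 / 8) \<partial>uniform_ball m) \<le> ennreal (6 * unit_ball_vol m) / ennreal (unit_ball_vol m)"
    unfolding uniform_ball_def
    by (subst nn_integral_uniform_measure) (auto simp: emeasure_unit_ball intro!: divide_right_mono_ennreal)
  also have "\<dots> = ennreal (6 * unit_ball_vol m / unit_ball_vol m)"
    by (intro divide_ennreal) (auto simp: unit_ball_vol_nonneg)
  also have "\<dots> = 6"
    using unit_ball_vol_pos[of m] by (simp add: less_imp_neq[THEN not_sym])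
  finally show ?thesis .
qed

section \<open>Row bounds for all sets of columns at once\<close>

text \<open>Keeping the second summand in the factors from \<open>T\<close> and bounding the others
  below by 1 yields (k/m)^k exp(m s/8), with s the sum of squares. One product thus controls every
  \<open>T\<close> of size k; the bound follows by taking logarithms.\<close>

lemma sum_squares_le_of_prod_less:
  fixes c :: "'a \<Rightarrow> real"
  assumes S: "finite S" "T \<subseteq> S" and k: "card T = k" "0 < k" "k \<le> m"
    and less: "(\<Prod>j\<in>S. 1 + k / m * exp (m * (c j)\<^sup>2 / 8)) < m ^ 4 * exp (6 * k)"
  shows "(\<Sum>j\<in>T. (c j)\<^sup>2) \<le> 40 * (k / m) * ln (100 * real m / k)"
proof -
  define s where "s = (\<Sum>j\<in>T. (c j)\<^sup>2)"
  define r where "r = ln (m / k)"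
  have m: "0 < m"
    using k by simp
  have "ln (100 * (m / k)) = ln 100 + r"
    unfolding r_def using k by (subst ln_mult) auto
  moreover have "ln 100 \<ge> (2 :: real)"
  proof -
    have "exp (2 :: real) = exp 1 * exp 1"
      by (simp flip: exp_add)
    also have "\<dots> \<le> 3 * 3"
      using exp_le by (intro mult_mono) auto
    finally show ?thesis
      by (subst ln_ge_iff) auto
  qed
  ultimately have ln100: "2 + r \<le> ln (100 * real m / k)"
    by simp
  have "r \<ge> 0"
    unfolding r_def using k by (intro ln_ge_zero) simp
  then have "r \<le> k * r"
    using k by (simp add: mult_le_cancel_right1)
  moreover have "ln k \<le> k"
    using ln_bound[of k] k by simp
  moreover have "ln m = r + ln k"
    using k by (simp add: r_def ln_div)
  ultimately have ln_m: "ln m \<le> k * r + k"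
    by linarith
  have "(k / m) ^ k * exp (m * s / 8) = (\<Prod>j\<in>T. k / m * exp (m * (c j)\<^sup>2 / 8))"
    unfolding prod.distrib prod_constant using k finite_subset[OF S(2,1)]
    by (simp add: s_def exp_sum sum_distrib_left sum_divide_distrib)
  also have "\<dots> \<le> (\<Prod>j\<in>T. 1 + k / m * exp (m * (c j)\<^sup>2 / 8))"
    by (intro prod_mono) auto
  also have "\<dots> \<le> (\<Prod>j\<in>S. 1 + k / m * exp (m * (c j)\<^sup>2 / 8))"
    using S by (intro prod_mono2) auto
  also note less
  finally have "ln ((k / m) ^ k * exp (m * s / 8)) < ln (m ^ 4 * exp (6 * k))"
    using k by (subst ln_less_cancel_iff) auto
  moreover have "ln ((k / m) ^ k * exp (m * s / 8)) = m * s / 8 - k * r"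
    using k by (simp add: ln_mult ln_realpow r_def ln_div algebra_simps)
  moreover have "ln (m ^ 4 * exp (6 * k)) = 4 * ln m + 6 * k"
    using m by (simp add: ln_mult ln_realpow)
  ultimately have "m * s / 8 \<le> 5 * (k * r) + 10 * k"
    using ln_m by linarith
  also have "\<dots> = 5 * (k * (2 + r))"
    by (simp add: algebra_simps)
  also have "\<dots> \<le> 5 * (k * ln (100 * real m / k))"
    using ln100 by (intro mult_left_mono) auto
  finally show ?thesis
    using m by (simp add: s_def field_simps)
qed

lemma measurable_random_columns_entry:
  assumes "i < m" "j < n"
  shows "(\<lambda>a. a j i) \<in> borel_measurable (random_columns m n)"
proof -
  have "(\<lambda>a. a j) \<in> random_columns m n \<rightarrow>\<^sub>M uniform_ball m"
    unfolding random_columns_def using assms by (intro measurable_component_singleton) simp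
  moreover have "(\<lambda>v. v i) \<in> borel_measurable (uniform_ball m)"
    using measurable_component_singleton[of i "{..<m}" "\<lambda>_. lborel :: real measure"] assms
    by (simp add: uniform_ball_def)
  ultimately show ?thesis
    by (rule measurable_compose)
qed

text \<open>By independence the expectation factors over the columns, and each factor is at most 1 +
  6y \<le> exp(6y).\<close>

lemma nn_integral_prod_random_columns:
  assumes "m \<ge> 2" "i < m" "y \<ge> 0"
  shows "(\<integral>\<^sup>+a. ennreal (\<Prod>j<n. 1 + y * exp (m * (a j i)\<^sup>2 / 8)) \<partial>random_columns m n) \<le> exp (6 * real n * y)"
proof -
  interpret ball: prob_space "uniform_ball m"
    by (rule prob_space_uniform_ball)
  interpret product_sigma_finite "\<lambda>_. uniform_ball m"
    by (simp add: product_sigma_finite_def ball.sigma_finite_measure_axioms)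
  have [measurable]: "(\<lambda>v. v i) \<in> borel_measurable (uniform_ball m)"
    using measurable_component_singleton[of i "{..<m}" "\<lambda>_. lborel :: real measure"] assms
    by (simp add: uniform_ball_def)
  have "(\<integral>\<^sup>+v. ennreal (1 + y * exp (m * (v i)\<^sup>2 / 8)) \<partial>uniform_ball m)
    = (\<integral>\<^sup>+v. 1 + ennreal y * ennreal (exp (m * (v i)\<^sup>2 / 8)) \<partial>uniform_ball m)"
    using assms by (intro nn_integral_cong) (simp add: ennreal_mult' ennreal_plus)
  also have "\<dots> = 1 + ennreal y * (\<integral>\<^sup>+v. ennreal (exp (m * (v i)\<^sup>2 / 8)) \<partial>uniform_ball m)"
    by (simp add: nn_integral_add nn_integral_cmult ball.emeasure_space_1)
  also have "\<dots> \<le> 1 + ennreal y * 6"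
    using assms by (intro add_left_mono mult_left_mono nn_integral_exp_square_uniform_ball) auto
  also have "\<dots> = ennreal (1 + 6 * y)"
    using assms by (simp add: ennreal_plus ennreal_mult' mult.commute)
  also have "\<dots> \<le> ennreal (exp (6 * y))"
    by (intro ennreal_leI exp_ge_add_one_self)
  finally have factor: "(\<integral>\<^sup>+v. ennreal (1 + y * exp (m * (v i)\<^sup>2 / 8)) \<partial>uniform_ball m) \<le> ennreal (exp (6 * y))" .
  have "(\<integral>\<^sup>+a. ennreal (\<Prod>j<n. 1 + y * exp (m * (a j i)\<^sup>2 / 8)) \<partial>random_columns m n)
    = (\<integral>\<^sup>+a. (\<Prod>j<n. ennreal (1 + y * exp (m * (a j i)\<^sup>2 / 8))) \<partial>random_columns m n)"
    using assms by (intro nn_integral_cong prod_ennreal[symmetric]) auto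
  also have "\<dots> = (\<Prod>j<n. \<integral>\<^sup>+v. ennreal (1 + y * exp (m * (v i)\<^sup>2 / 8)) \<partial>uniform_ball m)"
    unfolding random_columns_def
    by (rule product_nn_integral_prod[where f = "\<lambda>_ v. ennreal (1 + y * exp (m * (v i)\<^sup>2 / 8))"]) auto
  also have "\<dots> \<le> (\<Prod>j<n. ennreal (exp (6 * y)))"
    using factor by (intro prod_mono_ennreal) auto
  also have "\<dots> = ennreal (exp (6 * real n * y))"
    by (simp add: ennreal_power mult.assoc mult.left_commute flip: exp_of_nat_mult)
  finally show ?thesis .
qed

section \<open>Union bound over rows and subset sizes\<close>

theorem theorem3:
  shows "\<exists>C::real. C > 0 \<and>
    (\<forall>m n :: nat. 1 \<le> n \<and> n \<le> m \<longrightarrow>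
      \<P>(a in random_columns m n. disc m n (\<lambda>i j. a j i) \<le> C) \<ge> 1 - 1 / (real m)\<^sup>2)"
proof (intro exI[of _ "512 * sqrt 40"] conjI allI impI)
  fix m n :: nat
  assume mn: "1 \<le> n \<and> n \<le> m"
  define W where "W i k a = (\<Prod>j<n. 1 + real k / m * exp (m * (a j i)\<^sup>2 / 8))"
    for i k :: nat and a :: "nat \<Rightarrow> nat \<Rightarrow> real"
  \<comment> \<open>The mean of \<open>W i k\<close> is at most exp(6k) because n \<le> m. The extra
    factor \<open>m ^ 4\<close> makes Markov's bound small enough for a union over at most m^2 pairs
    of a row and a size.\<close>
  define bad where "bad i k = {a \<in> space (random_columns m n). m ^ 4 * exp (6 * k) \<le> W i k a}" for i k :: nat
  let ?good = "{a \<in> space (random_columns m n). disc m n (\<lambda>i j. a j i) \<le> 512 * sqrt 40}"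
  interpret prob_space "random_columns m n"
    by (rule prob_space_random_columns)
  show "1 - 1 / (real m)\<^sup>2 \<le> prob ?good"
  \<comment> \<open>For m = 1 the required probability is 0; the moment bounds assume m \<ge>
    2.\<close>
  proof (cases "m = 1")
    case False
    then have m: "m \<ge> 2"
      using mn by linarith
    have W[measurable]: "W i k \<in> borel_measurable (random_columns m n)" if "i < m" for i k
      unfolding W_def using that
      by (intro borel_measurable_prod borel_measurable_add borel_measurable_times borel_measurable_const
          measurable_compose[OF _ borel_measurable_exp] borel_measurable_divide borel_measurable_power
          measurable_random_columns_entry) auto
    have bad_sets: "bad i k \<in> events" if "i < m" for i k
      unfolding bad_def using W[OF that] by measurable
    have bad: "prob (bad i k) \<le> 1 / m ^ 4" if i: "i < m" for i k
    proof -
      \<comment> \<open>The reciprocal of the threshold, as Markov's inequality is applied to the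
        event that \<open>c\<close> times the variable is at least 1.\<close>
      define c where "c = 1 / (m ^ 4 * exp (6 * k))"
      have c: "c > 0"
        using m by (simp add: c_def)
      have "1 \<le> ennreal c * ennreal w \<longleftrightarrow> m ^ 4 * exp (6 * k) \<le> w" for w
      proof -
        have "1 \<le> ennreal c * ennreal w \<longleftrightarrow> ennreal 1 \<le> ennreal (c * w)"
          using c by (simp add: ennreal_mult')
        also have "\<dots> \<longleftrightarrow> 1 \<le> c * w"
          by (subst ennreal_le_iff2) auto
        also have "\<dots> \<longleftrightarrow> m ^ 4 * exp (6 * k) \<le> w"
          using m by (simp add: c_def field_simps)
        finally show ?thesis .
      qed
      then have "bad i k = {a \<in> space (random_columns m n). 1 \<le> ennreal c * ennreal (W i k a)}"
        by (auto simp: bad_def)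
      then have "emeasure (random_columns m n) (bad i k)
          \<le> ennreal c * (\<integral>\<^sup>+a. ennreal (W i k a) * indicator (space (random_columns m n)) a \<partial>random_columns m n)"
        using nn_integral_Markov_inequality[where u = "\<lambda>a. ennreal (W i k a)" and A = "space (random_columns m n)"
            and M = "random_columns m n" and c = "ennreal c"] W[OF i, of k]
        by simp
      also have "(\<integral>\<^sup>+a. ennreal (W i k a) * indicator (space (random_columns m n)) a \<partial>random_columns m n)
          = (\<integral>\<^sup>+a. ennreal (W i k a) \<partial>random_columns m n)"
        by (intro nn_integral_cong) simp
      also have "\<dots> \<le> ennreal (exp (6 * real n * (k / m)))"
        unfolding W_def using m i by (intro nn_integral_prod_random_columns) auto
      also have "\<dots> \<le> ennreal (exp (6 * k))"
      proof (intro ennreal_leI iffD2[OF exp_le_cancel_iff])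
        have "(6 * real k) * (n / m) \<le> (6 * real k) * 1"
          using mn by (intro mult_left_mono) auto
        then show "6 * real n * (k / m) \<le> real (6 * k)"
          by (simp add: mult_ac)
      qed
      finally have "emeasure (random_columns m n) (bad i k) \<le> ennreal c * ennreal (exp (6 * k))"
        by (simp add: mult_left_mono)
      also have "\<dots> = ennreal (1 / m ^ 4)"
        using c by (simp add: c_def flip: ennreal_mult')
      finally show ?thesis
        by (simp add: emeasure_eq_measure)
    qed
    \<comment> \<open>Only the size of a subset enters, not the subset itself; sizes start at 1, and
      the empty set is treated separately below.\<close>
    let ?I = "{..<m} \<times> {1..n}"
    have "prob (\<Union>(i, k)\<in>?I. bad i k) \<le> (\<Sum>(i, k)\<in>?I. prob (bad i k))"
      unfolding case_prod_unfold using bad_sets by (intro finite_measure_subadditive_finite) auto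
    also have "\<dots> \<le> (\<Sum>(i, k)\<in>?I. 1 / m ^ 4)"
      using bad by (intro sum_mono) auto
    also have "\<dots> = real (m * n) / m ^ 4"
      by simp
    also have "\<dots> \<le> real (m * m) / m ^ 4"
      using mn by (intro divide_right_mono) (auto simp del: of_nat_mult)
    also have "\<dots> = 1 / (real m)\<^sup>2"
      using m by (simp add: power2_eq_square power4_eq_xxxx)
    finally have "1 - 1 / (real m)\<^sup>2 \<le> 1 - prob (\<Union>(i, k)\<in>?I. bad i k)"
      by simp
    also have "\<dots> = prob (space (random_columns m n) - (\<Union>(i, k)\<in>?I. bad i k))"
      using bad_sets by (intro prob_compl[symmetric] sets.finite_UN) auto
    also have "\<dots> \<le> prob ?good"
    proof (rule finite_measure_mono)
      show "space (random_columns m n) - (\<Union>(i, k)\<in>?I. bad i k) \<subseteq> ?good"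
      proof safe
        fix a assume a: "a \<in> space (random_columns m n)" "a \<notin> (\<Union>(i, k)\<in>?I. bad i k)"
        have "\<exists>x. (\<forall>j\<in>{..<n}. x j \<in> {-1, 1}) \<and>
          (\<forall>i<m. \<bar>\<Sum>j<n. a j i * x j\<bar> \<le> 512 * sqrt 40 * root 4 (card {..<n} / m))"
        proof (rule full_coloring)
          fix i T assume i: "i < m" and T: "T \<subseteq> {..<n}"
          show "(\<Sum>j\<in>T. (a j i)\<^sup>2) \<le> 40 * (card T / m) * ln (100 * real m / card T)"
          proof (cases "T = {}")
            case False
            have k: "0 < card T" "card T \<le> n"
              using False T finite_subset[OF T] card_mono[OF _ T] by (auto simp: card_gt_0_iff)
            then have "(i, card T) \<in> ?I"
              using i by simp
            then have "a \<notin> bad i (card T)"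
              using a(2) by blast
            then have "W i (card T) a < m ^ 4 * exp (6 * card T)"
              using a(1) by (simp add: bad_def)
            then show ?thesis
              using T k mn by (intro sum_squares_le_of_prod_less[where S = "{..<n}"]) (auto simp: W_def)
          qed simp
        qed (use mn in auto)
        then obtain x where x: "\<And>j. j < n \<Longrightarrow> x j \<in> {-1, 1}"
          "\<And>i. i < m \<Longrightarrow> \<bar>\<Sum>j<n. a j i * x j\<bar> \<le> 512 * sqrt 40 * root 4 (n / m)"
          by auto
        \<comment> \<open>The row bound holds with B = 40, so this removes the dependence on n/m and
          leaves the absolute constant \<open>512 * sqrt 40\<close>.\<close>
        have "root 4 (n / m) \<le> 1"
          using mn by (subst real_root_le_1_iff) auto
        then have le: "512 * sqrt 40 * root 4 (n / m) \<le> 512 * sqrt 40"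
          by simp
        then show "disc m n (\<lambda>i j. a j i) \<le> 512 * sqrt 40"
          using x(1) m by (intro disc_le[of n x] order_trans[OF x(2) le]) auto
      qed
    qed measurable
    finally show ?thesis .
  qed simp
qed simp

end
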